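(* Let $A,X\in\mathbb{R}^{n\times n}$ be symmetric positive definite, let $R\in\mathbb{R}^{n_c\times n}$ have full row rank, and let $S\in\mathbb{R}^{n\times n_f}$, $n_f=n-n_c$, have full column rank and satisfy $RS=0$. Let $Z_\star\in\mathbb{R}^{n\times n_c}$ be a full rank matrix with $RZ_\star=I$. Then the min-max problem $$\mu_X^\star=\min_{P}\ \mu_X(PR),$$ where the minimum is over all $P\in\mathbb{R}^{n\times n_c}$ with $RP=I$, is solved by the ideal interpolation matrix $$P_\star=(I-\Pi_A(S))Z_\star=(I-S(S^TAS)^{-1}S^TA)Z_\star,$$ which satisfies $P_\star^TAS=0$. Moreover, the minimum has the closed form $$\mu_X^\star=\frac{1}{\lambda_{\min}\big((S^TXS)^{-1}(S^TAS)\big)}.$$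
   Context: Here $1\le n_c<n$. For $R\in\mathbb{R}^{n_c\times n}$ and $P\in\mathbb{R}^{n\times n_c}$ with $RP=I$, $$\mu_X(PR)=\sup_{\mathbf{v}\ne0}\frac{\|(I-PR)\mathbf{v}\|_X^2}{\|\mathbf{v}\|_A^2},\qquad \|\mathbf{v}\|_X^2=\mathbf{v}^TX\mathbf{v},\ \ \|\mathbf{v}\|_A^2=\mathbf{v}^TA\mathbf{v}.$$ For a full column rank matrix $S$, $\Pi_A(S)=S(S^TAS)^{-1}S^TA$ is the $A$-orthogonal projection onto $\operatorname{range}(S)$. $\lambda_{\min}(\cdot)$ denotes the smallest eigenvalue. *)

theory Defs
  imports "HOL-Analysis.Analysis"
begin

definition sym_pos_def :: "real^'n^'n \<Rightarrow> bool" where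
  "sym_pos_def M \<longleftrightarrow> transpose M = M \<and> (\<forall>v. v \<noteq> 0 \<longrightarrow> 0 < v \<bullet> (M *v v))"

definition norm_sq :: "real^'n^'n \<Rightarrow> real^'n \<Rightarrow> real" where
  "norm_sq M v = v \<bullet> (M *v v)"

(* The argument Q stands for the product P ** R.  The supremum is taken in the reals;
   for positive definite A the set of quotients is bounded, so it is a genuine supremum. *)
definition mu :: "real^'n^'n \<Rightarrow> real^'n^'n \<Rightarrow> real^'n^'n \<Rightarrow> real" where
  "mu A X Q = (SUP v\<in>{v. v \<noteq> 0}. norm_sq X ((mat 1 - Q) *v v) / norm_sq A v)"

definition interpolations :: "real^'n^'c \<Rightarrow> (real^'c^'n) set" where
  "interpolations R = {P. R ** P = mat 1}"

(* The value of the min-max problem, written as an infimum; that it is attained has to be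
   asserted separately. *)
definition mu_star :: "real^'n^'n \<Rightarrow> real^'n^'n \<Rightarrow> real^'n^'c \<Rightarrow> real" where
  "mu_star A X R = (INF P\<in>interpolations R. mu A X (P ** R))"

definition A_proj :: "real^'n^'n \<Rightarrow> real^'f^'n \<Rightarrow> real^'n^'n" where
  "A_proj A S = S ** matrix_inv (transpose S ** A ** S) ** transpose S ** A"

definition ideal_interpolation ::
    "real^'n^'n \<Rightarrow> real^'f^'n \<Rightarrow> real^'c^'n \<Rightarrow> real^'c^'n" where
  "ideal_interpolation A S Z = (mat 1 - A_proj A S) ** Z"

definition eigenvalues :: "real^'n^'n \<Rightarrow> real set" where
  "eigenvalues M = {l. \<exists>v. v \<noteq> 0 \<and> M *v v = l *s v}"

(* Only meaningful when M has a real spectrum, e.g. for M = inverse B ** C with B, C symmetric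
   and B positive definite, which is similar to a symmetric matrix. *)
definition lambda_min :: "real^'n^'n \<Rightarrow> real" where
  "lambda_min M = Min (eigenvalues M)"

end

theory Submission imports Defs begin

text \<open>
  Two facts about an interpolation \<open>P\<close> carry the result. Since \<open>R S = 0\<close>, the
  matrix \<open>I - P R\<close> fixes every vector of \<open>range S\<close>. Hence each \<open>\<mu>(P R)\<close> is at least the maximum
  \<open>M\<close> of \<open>\<parallel>v\<parallel>\<^sub>X\<^sup>2 / \<parallel>v\<parallel>\<^sub>A\<^sup>2\<close> over nonzero \<open>v\<close> in \<open>range S\<close>, whatever \<open>P\<close> is. On the other hand,
  \<open>R Z = I\<close> and the dimensions give \<open>\<real>\<^sup>n = range S \<oplus> range Z\<close>, and from this decomposition
  \<open>I - P R\<close> is exactly the \<open>A\<close>-orthogonal projection onto \<open>range S\<close> when \<open>P\<close> is the ideal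
  interpolation. The projection lands in \<open>range S\<close>, where the quotient is at most \<open>M\<close>, and it
  does not increase the \<open>A\<close>-norm; so the lower bound \<open>M\<close> is attained.

  It remains to identify \<open>M\<close>. With \<open>v = S w\<close>, \<open>B = S\<^sup>T X S\<close> and \<open>C = S\<^sup>T A S\<close>, the number \<open>1 / M\<close> is
  the minimum of the generalized Rayleigh quotient \<open>w\<^sup>T C w / w\<^sup>T B w\<close>. It is attained by
  compactness of the sphere. If \<open>m\<close> denotes its value, then \<open>C - m B\<close> is positive semidefinite, and
  its quadratic form vanishes at the minimizer, which is therefore in its kernel. So \<open>m\<close> is an
  eigenvalue of \<open>B\<^sup>-\<^sup>1 C\<close>. Every eigenvalue is a value of the quotient, hence \<open>m\<close> is the least one.
\<close>

section \<open>Quadratic forms\<close>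

lemma inner_matrix_vector_transpose:
  fixes M :: "real^'a^'b"
  shows "(M *v v) \<bullet> w = v \<bullet> (transpose M *v w)"
  by (metis dot_lmul_matrix inner_commute transpose_matrix_vector)

lemma norm_sq_congruence:
  fixes T :: "real^'a^'b"
  shows "norm_sq (transpose T ** M ** T) v = norm_sq M (T *v v)"
  unfolding norm_sq_def
  by (simp add: inner_matrix_vector_transpose flip: matrix_vector_mul_assoc
        del: transpose_matrix_vector)

lemma norm_sq_scaleR: "norm_sq M (c *\<^sub>R v) = c\<^sup>2 * norm_sq M v"
  by (simp add: norm_sq_def matrix_vector_mult_scaleR power2_eq_square)

lemma norm_sq_diff_scaleR: "norm_sq (M - c *\<^sub>R N) v = norm_sq M v - c * norm_sq N v"
  by (simp add: norm_sq_def matrix_vector_mult_diff_rdistrib inner_diff_right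
      flip: scaleR_matrix_vector_assoc)

lemma norm_sq_add:
  assumes "transpose M = M"
  shows "norm_sq M (v + w) = norm_sq M v + 2 * (v \<bullet> (M *v w)) + norm_sq M w"
proof -
  have "w \<bullet> (M *v v) = v \<bullet> (M *v w)"
    by (metis assms inner_commute inner_matrix_vector_transpose)
  then show ?thesis
    by (simp add: norm_sq_def matrix_vector_right_distrib inner_add_left inner_add_right)
qed

lemma norm_sq_0 [simp]: "norm_sq M 0 = 0"
  by (simp add: norm_sq_def)

lemma sym_pos_def_norm_sq_pos: "sym_pos_def M \<Longrightarrow> v \<noteq> 0 \<Longrightarrow> 0 < norm_sq M v"
  by (simp add: sym_pos_def_def norm_sq_def)

lemma sym_pos_def_norm_sq_nonneg: "sym_pos_def M \<Longrightarrow> 0 \<le> norm_sq M v"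
  by (cases "v = 0") (simp_all add: sym_pos_def_norm_sq_pos less_imp_le)

lemma sym_pos_def_congruence:
  fixes T :: "real^'a^'b"
  assumes "sym_pos_def M" "inj ((*v) T)"
  shows "sym_pos_def (transpose T ** M ** T)"
proof -
  have "0 < norm_sq (transpose T ** M ** T) v" if "v \<noteq> 0" for v
  proof -
    have "T *v v \<noteq> 0"
      using assms(2) that by (metis injD matrix_vector_mult_0_right)
    then show ?thesis
      using assms(1) by (simp add: norm_sq_congruence sym_pos_def_norm_sq_pos)
  qed
  moreover have "transpose (transpose T ** M ** T) = transpose T ** M ** T"
    using assms(1) by (simp add: sym_pos_def_def matrix_transpose_mul matrix_mul_assoc)
  ultimately show ?thesis
    unfolding sym_pos_def_def norm_sq_def by blast
qed

lemma sym_pos_def_invertible: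
  assumes "sym_pos_def M"
  shows "invertible M"
proof -
  have "v = 0" if "M *v v = 0" for v
    using assms that unfolding sym_pos_def_def by (metis inner_zero_right less_irrefl)
  then show ?thesis
    by (simp add: invertible_left_inverse matrix_left_invertible_ker)
qed

text \<open>
  Moving from a null vector \<open>v\<close> of the form in the direction \<open>-N v\<close> changes the form by
  \<open>-2 t \<parallel>N v\<parallel>\<^sup>2 + O(t\<^sup>2)\<close>, which would be negative for small \<open>t > 0\<close> if \<open>N v\<close> were nonzero.
\<close>

lemma pos_semidef_null_vector_in_kernel:
  assumes sym: "transpose N = N" and psd: "\<And>w. 0 \<le> norm_sq N w" and null: "norm_sq N v = 0"
  shows "N *v v = 0"
proof (rule ccontr)
  define y where "y = N *v v"
  define a where "a = y \<bullet> y"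
  define b where "b = norm_sq N y"
  define t where "t = a / (b + 1)"
  assume "N *v v \<noteq> 0"
  then have "a > 0" by (simp add: a_def y_def)
  have "b \<ge> 0" using psd by (simp add: b_def)
  then have "t > 0" "b * t < 2 * a"
    using \<open>a > 0\<close> by (auto simp: t_def field_simps intro!: add_nonneg_pos)
  have "v \<bullet> (N *v y) = a"
    by (metis a_def y_def sym inner_matrix_vector_transpose)
  then have "norm_sq N (v + (-t) *\<^sub>R y) = t * (b * t - 2 * a)"
    unfolding norm_sq_add[OF sym] norm_sq_scaleR
    by (simp only: null matrix_vector_mult_scaleR inner_scaleR_right)
       (simp add: b_def power2_eq_square algebra_simps)
  also have "\<dots> < 0"
    using \<open>t > 0\<close> \<open>b * t < 2 * a\<close> by (simp add: mult_less_0_iff)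
  finally show False using psd by (simp add: not_less[symmetric])
qed

section \<open>The generalized Rayleigh quotient\<close>

text \<open>The quotient is invariant under scaling, so its minimum over the unit sphere is global.\<close>

lemma rayleigh_quotient_attains_min:
  fixes N B :: "real^'a^'a"
  assumes "sym_pos_def B"
  obtains w where "w \<noteq> 0"
    and "\<And>v. v \<noteq> 0 \<Longrightarrow> norm_sq N w / norm_sq B w \<le> norm_sq N v / norm_sq B v"
proof -
  let ?q = "\<lambda>v. norm_sq N v / norm_sq B v"
  have nz: "norm_sq B v \<noteq> 0" if "v \<in> sphere 0 1" for v
    using sym_pos_def_norm_sq_pos[OF assms, of v] that by fastforce
  have "continuous_on (sphere 0 1) ?q"
    by (intro continuous_on_divide) (use nz in \<open>auto simp: norm_sq_def intro!: continuous_intros\<close>)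
  then obtain w where w: "w \<in> sphere 0 1" "\<And>v. v \<in> sphere 0 1 \<Longrightarrow> ?q w \<le> ?q v"
    using continuous_attains_inf[of "sphere (0::real^'a) 1" ?q] by auto
  have "?q w \<le> ?q v" if "v \<noteq> 0" for v
  proof -
    have "?q (inverse (norm v) *\<^sub>R v) = ?q v"
      using that by (simp add: norm_sq_scaleR)
    moreover have "inverse (norm v) *\<^sub>R v \<in> sphere 0 1"
      using that by simp
    ultimately show ?thesis using w(2) by metis
  qed
  moreover have "w \<noteq> 0" using w(1) by auto
  ultimately show thesis using that by blast
qed

lemma matrix_inv_inverse:
  assumes "invertible M"
  shows "M ** matrix_inv M = mat 1" "matrix_inv M ** M = mat 1"
  using someI_ex[OF assms[unfolded invertible_def]] by (simp_all add: matrix_inv_def)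

lemma eigenvalues_inverse_product_iff:
  assumes "invertible B"
  shows "l \<in> eigenvalues (matrix_inv B ** C) \<longleftrightarrow> (\<exists>v. v \<noteq> 0 \<and> C *v v = l *\<^sub>R (B *v v))"
proof -
  have inv: "B ** matrix_inv B = mat 1" "matrix_inv B ** B = mat 1"
    using assms by (simp_all add: matrix_inv_inverse)
  have "(matrix_inv B ** C) *v v = l *\<^sub>R v \<longleftrightarrow> C *v v = l *\<^sub>R (B *v v)" for v
  proof
    assume "(matrix_inv B ** C) *v v = l *\<^sub>R v"
    then have "B *v ((matrix_inv B ** C) *v v) = l *\<^sub>R (B *v v)"
      by (simp add: matrix_vector_mult_scaleR)
    then show "C *v v = l *\<^sub>R (B *v v)"
      by (simp add: matrix_vector_mul_assoc matrix_mul_assoc inv)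
  next
    assume "C *v v = l *\<^sub>R (B *v v)"
    then have "matrix_inv B *v (C *v v) = l *\<^sub>R (matrix_inv B *v (B *v v))"
      by (simp add: matrix_vector_mult_scaleR)
    then show "(matrix_inv B ** C) *v v = l *\<^sub>R v"
      by (simp add: matrix_vector_mul_assoc inv)
  qed
  then show ?thesis
    by (simp add: eigenvalues_def scalar_mult_eq_scaleR)
qed

text \<open>
  Eigenvectors for distinct eigenvalues of \<open>B\<^sup>-\<^sup>1 C\<close> are orthogonal for the inner product given by
  \<open>B\<close>, hence linearly independent, so there are at most as many eigenvalues as dimensions.
\<close>

lemma finite_eigenvalues_inverse_product:
  fixes B C :: "real^'a^'a"
  assumes B: "sym_pos_def B" and C: "transpose C = C"
  shows "finite (eigenvalues (matrix_inv B ** C))"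
proof -
  let ?E = "eigenvalues (matrix_inv B ** C)"
  obtain f where f: "\<And>l. l \<in> ?E \<Longrightarrow> f l \<noteq> 0 \<and> C *v f l = l *\<^sub>R (B *v f l)"
    using bchoice[of ?E "\<lambda>l v. v \<noteq> 0 \<and> C *v v = l *\<^sub>R (B *v v)"]
      eigenvalues_inverse_product_iff[OF sym_pos_def_invertible[OF B], of _ C] by blast
  have symB: "transpose B = B" using B by (simp add: sym_pos_def_def)
  have orth: "f l \<bullet> (B *v f k) = 0" if "l \<in> ?E" "k \<in> ?E" "l \<noteq> k" for l k
  proof -
    have "k * (f l \<bullet> (B *v f k)) = f l \<bullet> (C *v f k)"
      using f[OF that(2)] by simp
    also have "\<dots> = (C *v f l) \<bullet> f k"
      by (metis C inner_matrix_vector_transpose)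
    also have "\<dots> = l * ((B *v f l) \<bullet> f k)"
      using f[OF that(1)] by simp
    also have "\<dots> = l * (f l \<bullet> (B *v f k))"
      by (metis symB inner_matrix_vector_transpose)
    finally show ?thesis using that(3) by simp
  qed
  have pos: "0 < f l \<bullet> (B *v f l)" if "l \<in> ?E" for l
    using f[OF that] B by (simp add: sym_pos_def_def)
  have inj: "inj_on f ?E"
    by (rule inj_onI) (metis orth pos less_irrefl)
  have "independent (f ` ?E)"
    unfolding independent_explicit_module
  proof (intro allI impI)
    fix T u v
    assume T: "finite T" "T \<subseteq> f ` ?E" "(\<Sum>x\<in>T. u x *\<^sub>R x) = 0" "v \<in> T"
    have "0 = (\<Sum>x\<in>T. u x *\<^sub>R x) \<bullet> (B *v v)" using T by simp
    also have "\<dots> = (\<Sum>x\<in>T. u x * (x \<bullet> (B *v v)))"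
      by (simp add: inner_sum_left)
    also have "\<dots> = (\<Sum>x\<in>T. if x = v then u v * (v \<bullet> (B *v v)) else 0)"
      using T by (intro sum.cong) (auto simp: subset_iff image_iff, metis orth)
    also have "\<dots> = u v * (v \<bullet> (B *v v))"
      using T by simp
    finally show "u v = 0"
      using pos T by force
  qed
  then have "finite (f ` ?E)" by (rule finiteI_independent)
  then show ?thesis using inj finite_imageD by blast
qed

text \<open>
  If \<open>r\<close> is the minimum of the quotient, then \<open>C - r B\<close> is positive semidefinite and the minimizer is
  a null vector of its form, hence in its kernel: \<open>r\<close> is an eigenvalue of \<open>B\<^sup>-\<^sup>1 C\<close>. Conversely
  \<open>C v = l B v\<close> makes \<open>l\<close> the quotient at \<open>v\<close>, so no eigenvalue is below \<open>r\<close>.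
\<close>

lemma lambda_min_generalized_rayleigh:
  fixes B C :: "real^'a^'a"
  assumes B: "sym_pos_def B" and C: "sym_pos_def C"
  defines "m \<equiv> lambda_min (matrix_inv B ** C)"
  shows "m > 0" and "\<And>w. m * norm_sq B w \<le> norm_sq C w"
    and "\<exists>w. w \<noteq> 0 \<and> m * norm_sq B w = norm_sq C w"
proof -
  obtain w where w: "w \<noteq> 0"
    and min: "\<And>v. v \<noteq> 0 \<Longrightarrow> norm_sq C w / norm_sq B w \<le> norm_sq C v / norm_sq B v"
    using rayleigh_quotient_attains_min[OF B] by metis
  define r where "r = norm_sq C w / norm_sq B w"
  have Bpos: "norm_sq B v > 0" if "v \<noteq> 0" for v
    using B that by (rule sym_pos_def_norm_sq_pos)
  have rw: "r * norm_sq B w = norm_sq C w"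
    using Bpos[OF w] by (simp add: r_def)
  have le: "r * norm_sq B v \<le> norm_sq C v" for v
  proof (cases "v = 0")
    case False
    then show ?thesis
      using min[OF False] Bpos[OF False] by (simp add: r_def pos_le_divide_eq)
  qed simp
  have iff: "l \<in> eigenvalues (matrix_inv B ** C) \<longleftrightarrow> (\<exists>v. v \<noteq> 0 \<and> C *v v = l *\<^sub>R (B *v v))" for l
    by (rule eigenvalues_inverse_product_iff[OF sym_pos_def_invertible[OF B]])
  have symC: "transpose C = C" and symB: "transpose B = B"
    using B C by (simp_all add: sym_pos_def_def)
  have "transpose (C - r *\<^sub>R B) = C - r *\<^sub>R B"
    using symB symC by (simp add: transpose_def vec_eq_iff)
  then have "(C - r *\<^sub>R B) *v w = 0"
    using le rw by (intro pos_semidef_null_vector_in_kernel) (simp_all add: norm_sq_diff_scaleR)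
  then have "C *v w = r *\<^sub>R (B *v w)"
    by (simp add: matrix_vector_mult_diff_rdistrib flip: scaleR_matrix_vector_assoc)
  then have "r \<in> eigenvalues (matrix_inv B ** C)"
    using w iff by blast
  moreover have "r \<le> l" if eig: "l \<in> eigenvalues (matrix_inv B ** C)" for l
  proof -
    obtain v where v: "v \<noteq> 0" "C *v v = l *\<^sub>R (B *v v)" using eig iff by blast
    have "norm_sq C v = l * norm_sq B v"
      by (simp add: norm_sq_def v(2))
    then have "r * norm_sq B v \<le> l * norm_sq B v"
      using le[of v] by simp
    then show ?thesis
      using Bpos[OF v(1)] by simp
  qed
  ultimately have "m = r"
    unfolding m_def lambda_min_def
    by (intro Min_eqI finite_eigenvalues_inverse_product B symC) auto
  moreover have "r > 0"
    using sym_pos_def_norm_sq_pos[OF C w] Bpos[OF w] by (simp add: r_def)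
  ultimately show "m > 0" "\<And>w. m * norm_sq B w \<le> norm_sq C w"
    "\<exists>w. w \<noteq> 0 \<and> m * norm_sq B w = norm_sq C w"
    using le rw w by auto
qed

section \<open>The measure of an interpolation\<close>

text \<open>
  The quotients defining \<open>\<mu>\<close> form a Rayleigh quotient with numerator matrix \<open>(I - Q)\<^sup>T X (I - Q)\<close>;
  boundedness follows by minimizing the negated quotient.
\<close>

lemma mu_upper:
  fixes A X Q :: "real^'n^'n"
  assumes A: "sym_pos_def A" and "v \<noteq> 0"
  shows "norm_sq X ((mat 1 - Q) *v v) / norm_sq A v \<le> mu A X Q"
  unfolding mu_def
proof (rule cSUP_upper)
  let ?N = "transpose (mat 1 - Q) ** X ** (mat 1 - Q)"
  obtain w where w: "\<And>v. v \<noteq> 0 \<Longrightarrow> norm_sq (- ?N) w / norm_sq A w \<le> norm_sq (- ?N) v / norm_sq A v"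
    using rayleigh_quotient_attains_min[OF A] by metis
  have neg: "norm_sq (- ?N) v = - norm_sq X ((mat 1 - Q) *v v)" for v
    using norm_sq_diff_scaleR[of 0 1 ?N v] by (simp add: norm_sq_congruence) (simp add: norm_sq_def)
  show "bdd_above ((\<lambda>v. norm_sq X ((mat 1 - Q) *v v) / norm_sq A v) ` {v. v \<noteq> 0})"
    using w unfolding neg by (intro bdd_aboveI2) simp
qed (use assms in simp)

lemma mu_least:
  fixes A X Q :: "real^'n^'n"
  assumes "\<And>v. v \<noteq> 0 \<Longrightarrow> norm_sq X ((mat 1 - Q) *v v) / norm_sq A v \<le> c"
  shows "mu A X Q \<le> c"
  unfolding mu_def
proof (rule cSUP_least)
  have "(1 :: real^'n) \<noteq> 0" by simp
  then show "{v::real^'n. v \<noteq> 0} \<noteq> {}" by blast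
qed (use assms in simp)

section \<open>The ideal interpolation\<close>

text \<open>
  \<open>R\<close> annihilates \<open>range S\<close> and is injective on \<open>range Z\<close>, so the two ranges meet only in \<open>0\<close>, and
  their dimensions add up to that of the whole space. Applying \<open>R\<close> shows that the component in
  \<open>range Z\<close> is \<open>Z R v\<close>.
\<close>

lemma fine_coarse_decomposition:
  fixes R :: "real^'n^'c" and S :: "real^'f^'n" and Z :: "real^'c^'n"
  assumes rank: "rank S + rank Z = CARD('n)"
    and RS: "R ** S = 0" and RZ: "R ** Z = mat 1"
  obtains w where "v = S *v w + Z *v (R *v v)"
proof -
  let ?U = "range ((*v) S)" and ?V = "range ((*v) Z)"
  have RSw: "R *v (S *v w) = 0" and RZy: "R *v (Z *v y) = y" for w y
    using RS RZ by (simp_all add: matrix_vector_mul_assoc)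
  have sub: "subspace ?U" "subspace ?V"
    by (simp_all add: linear_subspace_image)
  have "?U \<inter> ?V \<subseteq> {0}"
    by clarsimp (metis RSw RZy matrix_vector_mult_0_right)
  then have "dim (?U \<inter> ?V) = 0"
    by (simp add: dim_eq_0)
  then have "dim {x + y |x y. x \<in> ?U \<and> y \<in> ?V} = DIM(real^'n)"
    using dim_sums_Int[OF sub] rank by (simp add: rank_dim_range del: dim_eq_0)
  then have "{x + y |x y. x \<in> ?U \<and> y \<in> ?V} = UNIV"
    using subspace_sums[OF sub] by (metis (no_types, lifting) dim_eq_full span_eq_iff)
  then obtain w y where v: "v = S *v w + Z *v y"
    by blast
  then have "R *v v = y"
    by (simp add: matrix_vector_right_distrib RSw RZy)
  then show thesis using v that by blast
qed

lemma A_proj_apply: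
  "A_proj A S *v v = S *v (matrix_inv (transpose S ** A ** S) *v ((transpose S ** A) *v v))"
  by (simp add: A_proj_def matrix_vector_mul_assoc matrix_mul_assoc)

lemma A_proj_fixes_range:
  assumes "invertible (transpose S ** A ** S)"
  shows "A_proj A S *v (S *v w) = S *v w"
proof -
  have "matrix_inv (transpose S ** A ** S) ** (transpose S ** A ** S) = mat 1"
    using assms by (simp add: matrix_inv_inverse)
  then show ?thesis
    unfolding A_proj_apply by (simp add: matrix_vector_mul_assoc flip: matrix_mul_assoc)
qed

lemma A_proj_residual_orthogonal:
  assumes "invertible (transpose S ** A ** S)"
  shows "transpose S ** A ** (mat 1 - A_proj A S) = 0"
proof -
  let ?C = "transpose S ** A ** S"
  have inv: "?C ** matrix_inv ?C = mat 1"
    using assms by (simp add: matrix_inv_inverse)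
  have "(transpose S ** A) *v (A_proj A S *v v) = (transpose S ** A) *v v" for v
  proof -
    have "(transpose S ** A) *v (A_proj A S *v v)
        = (?C ** matrix_inv ?C) *v ((transpose S ** A) *v v)"
      unfolding A_proj_apply by (simp only: matrix_vector_mul_assoc matrix_mul_assoc)
    then show ?thesis by (simp add: inv)
  qed
  then show ?thesis
    by (simp add: matrix_eq matrix_vector_mult_diff_distrib matrix_vector_mult_diff_rdistrib
        flip: matrix_vector_mul_assoc)
qed

text \<open>Pythagoras in the \<open>A\<close>-inner product: the residual is \<open>A\<close>-orthogonal to \<open>range S\<close>.\<close>

lemma norm_sq_A_proj_le:
  assumes A: "sym_pos_def A" and inv: "invertible (transpose S ** A ** S)"
  shows "norm_sq A (A_proj A S *v v) \<le> norm_sq A v"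
proof -
  define u where "u = (mat 1 - A_proj A S) *v v"
  have "transpose S *v (A *v u) = 0"
    unfolding u_def using A_proj_residual_orthogonal[OF inv]
    by (simp add: matrix_vector_mul_assoc matrix_mul_assoc del: transpose_matrix_vector)
  then have "(A_proj A S *v v) \<bullet> (A *v u) = 0"
    unfolding A_proj_apply inner_matrix_vector_transpose[of S] by simp
  moreover have "v = A_proj A S *v v + u"
    by (simp add: u_def matrix_vector_mult_diff_rdistrib)
  ultimately have "norm_sq A v = norm_sq A (A_proj A S *v v) + norm_sq A u"
    using A norm_sq_add[of A "A_proj A S *v v" u] by (simp add: sym_pos_def_def)
  then show ?thesis
    using sym_pos_def_norm_sq_nonneg[OF A, of u] by simp
qed

text \<open>
  On \<open>v = S w + Z R v\<close> the identity reads \<open>(I - \<Pi>) Z R v = (I - \<Pi>) (v - S w) = (I - \<Pi>) v\<close>, as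
  the projection \<open>\<Pi>\<close> fixes \<open>S w\<close>. In particular the result is the same for all choices of \<open>Z\<close>.
\<close>

lemma ideal_interpolation_complement:
  fixes R :: "real^'n^'c" and S :: "real^'f^'n" and Z :: "real^'c^'n"
  assumes inv: "invertible (transpose S ** A ** S)"
    and rank: "rank S + rank Z = CARD('n)"
    and RS: "R ** S = 0" and RZ: "R ** Z = mat 1"
  shows "mat 1 - ideal_interpolation A S Z ** R = A_proj A S"
proof -
  let ?I = "mat 1 - A_proj A S"
  have "(ideal_interpolation A S Z ** R) *v v = ?I *v v" for v
  proof -
    obtain w where v: "v = S *v w + Z *v (R *v v)"
      using fine_coarse_decomposition[OF rank RS RZ] .
    have "?I *v v = ?I *v (S *v w) + ?I *v (Z *v (R *v v))"
      using v by (metis matrix_vector_right_distrib)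
    also have "?I *v (S *v w) = 0"
      by (simp add: matrix_vector_mult_diff_rdistrib A_proj_fixes_range[OF inv])
    finally show ?thesis
      by (simp add: ideal_interpolation_def matrix_vector_mul_assoc matrix_mul_assoc)
  qed
  then have "ideal_interpolation A S Z ** R = ?I"
    by (simp add: matrix_eq)
  then show ?thesis by simp
qed

theorem lemma2:
  fixes A X :: "real^'n^'n"
    and R :: "real^'n^'c"
    and S :: "real^'f^'n"
    and Z :: "real^'c^'n"
  assumes "CARD('c) < CARD('n)"
    and "CARD('f) = CARD('n) - CARD('c)"
    and "sym_pos_def A"
    and "sym_pos_def X"
    and "rank R = CARD('c)"
    and "rank S = CARD('f)"
    and "R ** S = 0"
    and "rank Z = CARD('c)"
    and "R ** Z = mat 1"
  shows "is_arg_min (\<lambda>P. mu A X (P ** R)) (\<lambda>P. P \<in> interpolations R)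
           (ideal_interpolation A S Z)
       \<and> transpose (ideal_interpolation A S Z) ** A ** S = 0
       \<and> mu_star A X R =
           1 / lambda_min (matrix_inv (transpose S ** X ** S) ** (transpose S ** A ** S))"
proof -
  let ?B = "transpose S ** X ** S" and ?C = "transpose S ** A ** S"
  let ?P = "ideal_interpolation A S Z"
  define m where "m = lambda_min (matrix_inv ?B ** ?C)"
  note A = assms(3) and X = assms(4) and RS = assms(7) and RZ = assms(9)
  have rank: "rank S + rank Z = CARD('n)"
    using assms by simp
  have inj: "inj ((*v) S)"
    using assms(6) by (simp add: full_rank_injective)
  have injS: "S *v w \<noteq> 0" if "w \<noteq> 0" for w
    using inj that by (metis injD matrix_vector_mult_0_right)
  have B: "sym_pos_def ?B" and C: "sym_pos_def ?C"
    using A X inj by (simp_all add: sym_pos_def_congruence)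
  have inv: "invertible ?C" using C by (rule sym_pos_def_invertible)
  have m: "m > 0" "\<And>w. m * norm_sq X (S *v w) \<le> norm_sq A (S *v w)"
    and "\<exists>w. w \<noteq> 0 \<and> m * norm_sq X (S *v w) = norm_sq A (S *v w)"
    using lambda_min_generalized_rayleigh[OF B C] by (simp_all only: norm_sq_congruence m_def)
  then obtain w where w: "w \<noteq> 0" "m * norm_sq X (S *v w) = norm_sq A (S *v w)"
    by blast

  \<comment> \<open>The vector \<open>S w\<close>, which no \<open>P\<close> can remove from the error, already has quotient \<open>1 / m\<close>.\<close>
  have lower: "1 / m \<le> mu A X (P ** R)" for P
  proof -
    have "R *v (S *v w) = 0"
      using RS by (simp add: matrix_vector_mul_assoc)
    then have "(mat 1 - P ** R) *v (S *v w) = S *v w"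
      by (simp add: matrix_vector_mult_diff_rdistrib flip: matrix_vector_mul_assoc)
    then have "norm_sq X (S *v w) / norm_sq A (S *v w) \<le> mu A X (P ** R)"
      using mu_upper[OF A injS[OF w(1)]] by metis
    moreover have "norm_sq X (S *v w) / norm_sq A (S *v w) = 1 / m"
      using sym_pos_def_norm_sq_pos[OF X injS[OF w(1)]] \<open>m > 0\<close> by (simp flip: w(2))
    ultimately show ?thesis by simp
  qed

  \<comment> \<open>The error of the ideal interpolation lies in \<open>range S\<close> and has no larger \<open>A\<close>-norm than \<open>v\<close>.\<close>
  have "mu A X (?P ** R) \<le> 1 / m"
  proof (rule mu_least)
    fix v :: "real^'n" assume "v \<noteq> 0"
    let ?p = "A_proj A S *v v"
    have "m * norm_sq X ?p \<le> norm_sq A ?p"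
      unfolding A_proj_apply by (rule m(2))
    also have "\<dots> \<le> norm_sq A v"
      by (rule norm_sq_A_proj_le[OF A inv])
    finally show "norm_sq X ((mat 1 - ?P ** R) *v v) / norm_sq A v \<le> 1 / m"
      using \<open>m > 0\<close> sym_pos_def_norm_sq_pos[OF A \<open>v \<noteq> 0\<close>]
      by (simp add: ideal_interpolation_complement[OF inv rank RS RZ] field_simps)
  qed
  then have val: "mu A X (?P ** R) = 1 / m"
    using lower by (simp add: antisym)

  have "R ** A_proj A S = 0"
    using RS by (simp add: A_proj_def matrix_mul_assoc)
  then have "R ** ?P = mat 1"
    using RZ by (simp add: ideal_interpolation_def matrix_eq matrix_vector_mult_diff_distrib
        matrix_vector_mult_diff_rdistrib matrix_vector_mul_assoc[symmetric])
  then have P: "?P \<in> interpolations R" by (simp add: interpolations_def)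

  have "transpose (transpose ?P ** A ** S) = transpose S ** A ** ?P"
    using A by (simp add: sym_pos_def_def matrix_transpose_mul matrix_mul_assoc)
  also have "\<dots> = (transpose S ** A ** (mat 1 - A_proj A S)) ** Z"
    by (simp add: ideal_interpolation_def matrix_mul_assoc)
  also have "\<dots> = transpose 0"
    unfolding A_proj_residual_orthogonal[OF inv] by (simp add: transpose_def vec_eq_iff)
  finally have orth: "transpose ?P ** A ** S = 0"
    by (simp only: transpose_iff)

  have "mu_star A X R = 1 / m"
    unfolding mu_star_def using P val lower by (intro cInf_eq_minimum) (auto intro: rev_image_eqI)
  then show ?thesis
    using P val lower orth by (simp add: is_arg_min_linorder m_def)
qed

end
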